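(* Let $X$ be a finite set and let $\operatorname{FIM}(X)$ be the free inverse monoid on $X$, with its finite monoid generating set $X^{\pm} = X \cup X^{-1}$. Let $\#$ be a symbol not in $X^{\pm}$. Then the word problem of $\operatorname{FIM}(X)$ is co-context-free; that is, the language $$\mathrm{WP}(\operatorname{FIM}(X), X^{\pm}) = \{\, u\# v^{\mathrm{rev}} : u, v \in (X^{\pm})^*,\ u =_{\operatorname{FIM}(X)} v \,\}$$ is the complement in $(X^{\pm} \cup \{\#\})^*$ of a context-free language.
   Context: Notation. For each $x \in X$ let $x^{-1}$ be a new symbol not in $X$ (distinct for distinct $x$), let $X^{-1} = \{x^{-1} : x \in X\}$ and $X^{\pm} = X \cup X^{-1}$, with the convention $(x^{-1})^{-1} = x$. For a word $v$, $v^{\mathrm{rev}}$ denotes the reverse of $v$. We write $\varepsilon$ for the empty word, and $u =_M v$ means that the words $u$ and $v$ represent the same element of the monoid $M$. Free inverse monoid. Let $\operatorname{FG}(X)$ be the free group on $X$, its elements being identified with reduced words over $X^{\pm}$. The Munn tree of a word $w = w_1 \cdots w_n \in (X^{\pm})^*$ is the bi-rooted tree $(\varepsilon, T_w, g_w)$, where $T_w$ is the finite subtree of the Cayley graph of $\operatorname{FG}(X)$ (with respect to $X$; edges are regarded as traversable in both directions) consisting of all vertices and edges visited when one starts at the vertex $\varepsilon$ and reads $w$ from left to right (from vertex $g$, reading the letter $w_i \in X^{\pm}$ moves along the edge between $g$ and $g w_i$), and $g_w$ is the final vertex, i.e. the element of $\operatorname{FG}(X)$ represented by $w$. Two words represent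 the same element of the free inverse monoid $\operatorname{FIM}(X)$ if and only if they have the same Munn tree (same subtree and same terminal vertex). Thus $\operatorname{FIM}(X)$ is the monoid of Munn trees, with product $(\varepsilon, T_w, g_w)(\varepsilon, T_v, g_v) = (\varepsilon, T_w \cup g_w T_v, g_w g_v)$. Word problem. The word problem of a monoid $M$ with respect to a finite generating set $A$ is the language $\mathrm{WP}(M,A) = \{u\#v^{\mathrm{rev}} : u,v \in A^*,\ u =_M v\}$, where $\#\notin A$. A language is co-context-free if it is the complement of a context-free language. Having co-context-free word problem is regarded as a property of the monoid, not depending on the choice of finite generating set. *)

theory Defs
  imports "HOL-Algebra.Group"
begin

section \<open>Context-free and co-context-free languages\<close>

datatype ('n, 't) symb = Nt 'n | Tm 't

record ('n, 't) cfg =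
  nonterminals :: "'n set"
  terminals :: "'t set"
  productions :: "('n \<times> ('n, 't) symb list) set"
  start :: 'n

definition wf_cfg :: "('n, 't) cfg \<Rightarrow> bool" where
  "wf_cfg G \<longleftrightarrow> finite (nonterminals G) \<and> finite (terminals G) \<and> finite (productions G)
     \<and> start G \<in> nonterminals G
     \<and> productions G \<subseteq>
         nonterminals G \<times> lists (Nt ` nonterminals G \<union> Tm ` terminals G)"

definition derives1 :: "('n, 't) cfg \<Rightarrow> ('n, 't) symb list \<Rightarrow> ('n, 't) symb list \<Rightarrow> bool" where
  "derives1 G u v \<longleftrightarrow>
     (\<exists>p q A r. (A, r) \<in> productions G \<and> u = p @ [Nt A] @ q \<and> v = p @ r @ q)"

definition cfg_lang :: "('n, 't) cfg \<Rightarrow> 't list set" where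
  "cfg_lang G = {w \<in> lists (terminals G). (derives1 G)\<^sup>*\<^sup>* [Nt (start G)] (map Tm w)}"

text \<open>A grammar has only finitely many nonterminals, so taking them to be natural numbers is
  no restriction.\<close>

definition context_free_over :: "'t set \<Rightarrow> 't list set \<Rightarrow> bool" where
  "context_free_over \<Sigma> L \<longleftrightarrow>
     (\<exists>G :: (nat, 't) cfg. wf_cfg G \<and> terminals G = \<Sigma> \<and> L = cfg_lang G)"

definition co_context_free_over :: "'t set \<Rightarrow> 't list set \<Rightarrow> bool" where
  "co_context_free_over \<Sigma> L \<longleftrightarrow> (\<exists>K. context_free_over \<Sigma> K \<and> L = lists \<Sigma> - K)"


section \<open>Word problem of a monoid\<close>

text \<open>The letters of the generating alphabet are interpreted in \<open>M\<close> by \<open>\<iota>\<close>.\<close>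

definition word_eval :: "('m, 'b) monoid_scheme \<Rightarrow> ('s \<Rightarrow> 'm) \<Rightarrow> 's list \<Rightarrow> 'm" where
  "word_eval M \<iota> w = foldr (\<lambda>a m. \<iota> a \<otimes>\<^bsub>M\<^esub> m) w \<one>\<^bsub>M\<^esub>"

text \<open>The symbol \<open>#\<close> is \<open>None\<close>; a letter \<open>a\<close> becomes \<open>Some a\<close>.\<close>

definition hash_alphabet :: "'s set \<Rightarrow> 's option set" where
  "hash_alphabet A = insert None (Some ` A)"

definition word_problem :: "('m, 'b) monoid_scheme \<Rightarrow> ('s \<Rightarrow> 'm) \<Rightarrow> 's set \<Rightarrow> 's option list set" where
  "word_problem M \<iota> A =
     {map Some u @ [None] @ map Some (rev v) | u v.
        u \<in> lists A \<and> v \<in> lists A \<and> word_eval M \<iota> u = word_eval M \<iota> v}"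


section \<open>The free group as reduced words\<close>

datatype 'a letter = Pos 'a | Neg 'a

primrec inv_letter :: "'a letter \<Rightarrow> 'a letter" where
  "inv_letter (Pos x) = Neg x"
| "inv_letter (Neg x) = Pos x"

definition letters :: "'a set \<Rightarrow> 'a letter set" where
  "letters X = Pos ` X \<union> Neg ` X"

definition reduced :: "'a letter list \<Rightarrow> bool" where
  "reduced w \<longleftrightarrow> successively (\<lambda>a b. b \<noteq> inv_letter a) w"

fun push :: "'a letter \<Rightarrow> 'a letter list \<Rightarrow> 'a letter list" where
  "push a [] = [a]"
| "push a (b # w) = (if b = inv_letter a then w else a # b # w)"

definition reduce :: "'a letter list \<Rightarrow> 'a letter list" where
  "reduce w = foldr push w []"

definition free_group :: "'a set \<Rightarrow> 'a letter list monoid" where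
  "free_group X = \<lparr>carrier = {w \<in> lists (letters X). reduced w},
                   mult = (\<lambda>g h. reduce (g @ h)), one = []\<rparr>"


section \<open>Munn trees and the free inverse monoid\<close>

text \<open>A subgraph of the Cayley graph is given by its vertices and its edges; the edge from \<open>g\<close>
  to \<open>g x\<close> labelled \<open>x\<close>, for \<open>x\<close> in \<open>X\<close>, is the triple \<open>(g, x, g x)\<close>. Reading \<open>x\<close> or its
  inverse traverses such an edge forwards or backwards.\<close>

type_synonym 'a cayley_edge = "'a letter list \<times> 'a \<times> 'a letter list"
type_synonym 'a subgraph = "'a letter list set \<times> 'a cayley_edge set"

fun read_edge :: "'a letter list \<Rightarrow> 'a letter \<Rightarrow> 'a cayley_edge" where
  "read_edge g (Pos x) = (g, x, reduce (g @ [Pos x]))"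
| "read_edge g (Neg x) = (reduce (g @ [Neg x]), x, g)"

definition munn_subtree :: "'a letter list \<Rightarrow> 'a subgraph" where
  "munn_subtree w =
     ({reduce (take i w) | i. i \<le> length w},
      {read_edge (reduce (take i w)) (w ! i) | i. i < length w})"

text \<open>The first root of a Munn tree is always the empty word and is left implicit.\<close>

type_synonym 'a munn = "'a subgraph \<times> 'a letter list"

definition munn_tree :: "'a letter list \<Rightarrow> 'a munn" where
  "munn_tree w = (munn_subtree w, reduce w)"

definition subgraph_union :: "'a subgraph \<Rightarrow> 'a subgraph \<Rightarrow> 'a subgraph" where
  "subgraph_union S T = (fst S \<union> fst T, snd S \<union> snd T)"

definition translate :: "'a set \<Rightarrow> 'a letter list \<Rightarrow> 'a subgraph \<Rightarrow> 'a subgraph" where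
  "translate X g T =
     ((\<lambda>h. g \<otimes>\<^bsub>free_group X\<^esub> h) ` fst T,
      (\<lambda>(h, x, k). (g \<otimes>\<^bsub>free_group X\<^esub> h, x, g \<otimes>\<^bsub>free_group X\<^esub> k)) ` snd T)"

definition munn_mult :: "'a set \<Rightarrow> 'a munn \<Rightarrow> 'a munn \<Rightarrow> 'a munn" where
  "munn_mult X t s =
     (subgraph_union (fst t) (translate X (snd t) (fst s)), snd t \<otimes>\<^bsub>free_group X\<^esub> snd s)"

definition FIM :: "'a set \<Rightarrow> 'a munn monoid" where
  "FIM X = \<lparr>carrier = munn_tree ` lists (letters X),
            mult = munn_mult X, one = (({[]}, {}), [])\<rparr>"

definition FIM_gen :: "'a letter \<Rightarrow> 'a munn" where
  "FIM_gen a = munn_tree [a]"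


section \<open>Consistency of the definitions\<close>

lemma inv_letter_invol [simp]: "inv_letter (inv_letter a) = a"
  by (cases a) auto

lemma inv_letter_neq [simp]: "inv_letter a \<noteq> a" "a \<noteq> inv_letter a"
  by (cases a; simp)+

lemma inv_letter_mem [simp]: "inv_letter a \<in> letters X \<longleftrightarrow> a \<in> letters X"
  by (cases a) (auto simp: letters_def)

lemma reduced_Nil [simp]: "reduced []"
  by (simp add: reduced_def)

lemma reduced_push: "reduced w \<Longrightarrow> reduced (push a w)"
  by (cases w) (auto simp: reduced_def successively_Cons)

lemma reduced_foldr_push: "reduced w \<Longrightarrow> reduced (foldr push u w)"
  by (induction u) (auto intro: reduced_push)

lemma reduced_reduce [simp]: "reduced (reduce w)"
  by (simp add: reduce_def reduced_foldr_push)

lemma push_reduced: "reduced (a # w) \<Longrightarrow> push a w = a # w"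
  by (cases w) (auto simp: reduced_def)

lemma reduce_reduced [simp]: "reduced w \<Longrightarrow> reduce w = w"
proof (induction w)
  case (Cons a w)
  then have "reduced w" by (auto simp: reduced_def successively_Cons)
  with Cons have "foldr push w [] = w" by (simp add: reduce_def)
  with Cons.prems show ?case by (simp add: reduce_def push_reduced)
qed (simp add: reduce_def)

lemma push_inv: "reduced w \<Longrightarrow> push (inv_letter a) (push a w) = w"
proof (cases w)
  case (Cons b v)
  assume "reduced w"
  with Cons show ?thesis
    by (cases v) (auto simp: reduced_def)
qed simp

lemma push_inv': "reduced w \<Longrightarrow> push a (push (inv_letter a) w) = w"
  using push_inv[of w "inv_letter a"] by simp

lemma foldr_push_push:
  "reduced w \<Longrightarrow> foldr push (push a u) w = push a (foldr push u w)"
  by (cases u) (auto simp: push_inv' reduced_foldr_push)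

lemma foldr_push_reduce: "reduced w \<Longrightarrow> foldr push (reduce u) w = foldr push u w"
  by (induction u) (auto simp: reduce_def foldr_push_push)

lemma reduce_append_left [simp]: "reduce (reduce u @ v) = reduce (u @ v)"
  using foldr_push_reduce[of "foldr push v []" u]
  by (simp add: reduce_def reduced_foldr_push)

lemma reduce_append_right [simp]: "reduce (u @ reduce v) = reduce (u @ v)"
  using reduce_reduced[OF reduced_reduce, of v] by (simp add: reduce_def)

lemma push_lists: "a \<in> A \<Longrightarrow> w \<in> lists A \<Longrightarrow> push a w \<in> lists A"
  by (cases w) auto

lemma reduce_lists: "w \<in> lists A \<Longrightarrow> reduce w \<in> lists A"
proof (induction w)
  case (Cons a w)
  then show ?case using push_lists[of a A "reduce w"] by (simp add: reduce_def)
qed (simp add: reduce_def)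

lemma reduce_inverse: "reduce (map inv_letter (rev w) @ w) = []"
proof (induction w)
  case (Cons a w)
  have "reduce (map inv_letter (rev (a # w)) @ a # w)
      = foldr push (map inv_letter (rev w)) (push (inv_letter a) (push a (foldr push w [])))"
    by (simp add: reduce_def)
  also have "\<dots> = reduce (map inv_letter (rev w) @ w)"
    by (simp add: push_inv reduced_foldr_push reduce_def)
  finally show ?case using Cons by simp
qed (simp add: reduce_def)

lemma group_free_group: "group (free_group X)"
proof (rule groupI)
  fix g assume g: "g \<in> carrier (free_group X)"
  let ?h = "reduce (map inv_letter (rev g))"
  have "map inv_letter (rev g) \<in> lists (letters X)"
    using g by (auto simp: free_group_def)
  then have "?h \<in> carrier (free_group X)"
    using reduce_lists[of "map inv_letter (rev g)" "letters X"] by (simp add: free_group_def)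
  moreover have "?h \<otimes>\<^bsub>free_group X\<^esub> g = \<one>\<^bsub>free_group X\<^esub>"
    by (simp add: free_group_def reduce_inverse)
  ultimately show "\<exists>h\<in>carrier (free_group X). h \<otimes>\<^bsub>free_group X\<^esub> g = \<one>\<^bsub>free_group X\<^esub>"
    by blast
qed (use reduce_lists[of "_ @ _" "letters X"] in \<open>auto simp: free_group_def\<close>)

lemma word_eval_free_group: "word_eval (free_group X) (\<lambda>a. [a]) w = reduce w"
proof (induction w)
  case (Cons a w)
  then show ?case
    using reduce_append_right[of "[a]" w] by (simp add: word_eval_def free_group_def)
qed (simp add: word_eval_def free_group_def reduce_def)

lemma read_edge_append:
  "read_edge (reduce (u @ v)) a
     = (\<lambda>(h, x, k). (reduce (u @ h), x, reduce (u @ k))) (read_edge (reduce v) a)"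
  by (cases a) auto

lemma munn_tree_append: "munn_mult X (munn_tree u) (munn_tree v) = munn_tree (u @ v)"
proof -
  let ?n = "length u"
  have V: "{reduce (take i (u @ v)) | i. i \<le> length (u @ v)}
      = {reduce (take i u) | i. i \<le> ?n} \<union>
        (\<lambda>h. reduce (reduce u @ h)) ` {reduce (take i v) | i. i \<le> length v}" (is "?A = ?B \<union> ?C")
  proof (intro equalityI subsetI)
    fix g assume "g \<in> ?A"
    then obtain i where i: "g = reduce (take i (u @ v))" "i \<le> length (u @ v)" by blast
    show "g \<in> ?B \<union> ?C"
    proof (cases "i \<le> ?n")
      case True then show ?thesis using i by auto
    next
      case False
      then have "g = reduce (reduce u @ reduce (take (i - ?n) v))" "i - ?n \<le> length v"
        using i by auto
      then show ?thesis by blast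
    qed
  next
    fix g assume "g \<in> ?B \<union> ?C"
    then consider i where "g = reduce (take i u)" "i \<le> ?n"
      | i where "g = reduce (u @ take i v)" "i \<le> length v" by auto
    then show "g \<in> ?A"
    proof cases
      case 1 then show ?thesis by (intro CollectI exI[of _ i]) auto
    next
      case 2 then show ?thesis by (intro CollectI exI[of _ "?n + i"]) auto
    qed
  qed
  let ?f = "\<lambda>(h, x, k). (reduce (reduce u @ h), x, reduce (reduce u @ k))"
  have E: "{read_edge (reduce (take i (u @ v))) ((u @ v) ! i) | i. i < length (u @ v)}
      = {read_edge (reduce (take i u)) (u ! i) | i. i < ?n} \<union>
        ?f ` {read_edge (reduce (take i v)) (v ! i) | i. i < length v}" (is "?A = ?B \<union> ?f ` ?D")
  proof (intro equalityI subsetI)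
    fix e assume "e \<in> ?A"
    then obtain i where i: "e = read_edge (reduce (take i (u @ v))) ((u @ v) ! i)"
      "i < length (u @ v)" by blast
    show "e \<in> ?B \<union> ?f ` ?D"
    proof (cases "i < ?n")
      case True then show ?thesis using i by (auto simp: nth_append)
    next
      case False
      then have "e = ?f (read_edge (reduce (take (i - ?n) v)) (v ! (i - ?n)))" "i - ?n < length v"
        using i by (auto simp: nth_append read_edge_append)
      then show ?thesis by blast
    qed
  next
    fix e assume "e \<in> ?B \<union> ?f ` ?D"
    then consider i where "e = read_edge (reduce (take i u)) (u ! i)" "i < ?n"
      | i where "e = ?f (read_edge (reduce (take i v)) (v ! i))" "i < length v" by blast
    then show "e \<in> ?A"
    proof cases
      case 1 then show ?thesis by (intro CollectI exI[of _ i]) (auto simp: nth_append)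
    next
      case 2 then show ?thesis
        by (intro CollectI exI[of _ "?n + i"]) (auto simp: nth_append read_edge_append)
    qed
  qed
  show ?thesis
    unfolding munn_mult_def munn_tree_def munn_subtree_def subgraph_union_def translate_def
    by (simp only: fst_conv snd_conv V E) (simp add: free_group_def)
qed

lemma munn_tree_Nil: "munn_tree [] = \<one>\<^bsub>FIM X\<^esub>"
  by (simp add: munn_tree_def munn_subtree_def FIM_def reduce_def)

lemma monoid_FIM: "monoid (FIM X)"
proof -
  have mult: "munn_tree u \<otimes>\<^bsub>FIM X\<^esub> munn_tree v = munn_tree (u @ v)" for u v :: "'a letter list"
    by (simp add: FIM_def munn_tree_append)
  have carr: "carrier (FIM X) = munn_tree ` lists (letters X)"
    by (simp add: FIM_def)
  show ?thesis
    by (rule monoidI; unfold carr munn_tree_Nil[of X, symmetric])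
       (auto simp: mult intro!: imageI)
qed

text \<open>Two words represent the same element of the free inverse monoid iff they have the same
  Munn tree.\<close>

lemma word_eval_FIM: "word_eval (FIM X) FIM_gen w = munn_tree w"
proof (induction w)
  case Nil
  show ?case by (simp add: word_eval_def munn_tree_Nil[of X])
next
  case (Cons a w)
  then show ?case
    using munn_tree_append[of X "[a]" w] by (simp add: word_eval_def FIM_gen_def FIM_def)
qed

lemma FIM_generated: "carrier (FIM X) = word_eval (FIM X) FIM_gen ` lists (letters X)"
  by (simp add: FIM_def word_eval_FIM[abs_def, unfolded FIM_def])

end

theory Submission
  imports Defs
begin

text \<open>A Munn tree is determined by its vertices and its terminal vertex. If \<open>u\<close> and \<open>v\<close> have the
  same value in the free group, their trees have the same vertices iff the same group elements are
  values of suffixes of \<open>u\<close> and of \<open>v\<close>. Hence \<open>u # rev v\<close> lies outside the word problem iff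
  \<open>u\<close> and \<open>v\<close> differ in the free group, or \<open>u\<close> has a suffix \<open>r\<close> whose value is not that of a suffix
  of \<open>v\<close>, or vice versa. In the second case a pushdown automaton guesses where \<open>r\<close> begins and
  keeps the reduced form of \<open>t r\<^sup>-\<^sup>1\<close> on its stack, \<open>rev t\<close> being the part of \<open>rev v\<close> read so far:
  the stack must never be trivial after the hash. The third case is the second one reversed. Testing
  suffixes instead of prefixes matters, since \<open>rev v\<close> reveals \<open>v\<close> from its end.\<close>

section \<open>Words generated by a grammar\<close>

text \<open>A big-step counterpart of derivation: every nonterminal of the sentential form is
  expanded completely, from left to right. Rule induction over derivation forests thus replaces
  bookkeeping of the positions at which \<open>derives1\<close> rewrites.\<close>

inductive gen :: "('n \<times> ('n, 't) symb list) set \<Rightarrow> ('n, 't) symb list \<Rightarrow> 't list \<Rightarrow> bool"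
  for P where
  Nil: "gen P [] []"
| Tm: "gen P ss w \<Longrightarrow> gen P (Tm t # ss) (t # w)"
| Nt: "(A, r) \<in> P \<Longrightarrow> gen P r v \<Longrightarrow> gen P ss w \<Longrightarrow> gen P (Nt A # ss) (v @ w)"

inductive_cases gen_NilE: "gen P [] w"
inductive_cases gen_TmE: "gen P (Tm t # ss) w"
inductive_cases gen_NtE: "gen P (Nt A # ss) w"

lemma gen_append: "gen P ss v \<Longrightarrow> gen P ss' w \<Longrightarrow> gen P (ss @ ss') (v @ w)"
  by (induction rule: gen.induct) (auto intro: gen.intros)

lemma gen_appendE:
  assumes "gen P (ss @ ss') w"
  obtains v v' where "w = v @ v'" "gen P ss v" "gen P ss' v'"
  using assms
proof (induction ss arbitrary: w thesis)
  case Nil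
  then show ?case by (auto intro: gen.Nil)
next
  case (Cons s ss)
  show ?case
  proof (cases s)
    case (Nt A)
    with Cons.prems(2) obtain r v1 v2 where
      *: "w = v1 @ v2" "(A, r) \<in> P" "gen P r v1" "gen P (ss @ ss') v2"
      by (auto elim: gen_NtE)
    from Cons.IH[OF _ *(4)] obtain x y where "v2 = x @ y" "gen P ss x" "gen P ss' y" by blast
    with * Nt show ?thesis using Cons.prems(1)[of "v1 @ x" y] by (auto intro: gen.Nt)
  next
    case (Tm t)
    with Cons.prems(2) obtain v2 where *: "w = t # v2" "gen P (ss @ ss') v2"
      by (auto elim: gen_TmE)
    from Cons.IH[OF _ *(2)] obtain x y where "v2 = x @ y" "gen P ss x" "gen P ss' y" by blast
    with * Tm show ?thesis using Cons.prems(1)[of "t # x" y] by (auto intro: gen.Tm)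
  qed
qed

lemma gen_terminals: "gen P (map Tm w) w"
  by (induction w) (auto intro: gen.intros)

lemma gen_Nt_single: "gen P [Nt A] w \<longleftrightarrow> (\<exists>r. (A, r) \<in> P \<and> gen P r w)"
proof
  assume "gen P [Nt A] w"
  then show "\<exists>r. (A, r) \<in> P \<and> gen P r w" by (auto elim!: gen_NtE gen_NilE)
next
  assume "\<exists>r. (A, r) \<in> P \<and> gen P r w"
  then show "gen P [Nt A] w" using gen.Nt[OF _ _ gen.Nil] by fastforce
qed

lemma derives_context:
  "(derives1 G)\<^sup>*\<^sup>* u v \<Longrightarrow> (derives1 G)\<^sup>*\<^sup>* (p @ u @ q) (p @ v @ q)"
proof (induction rule: rtranclp_induct)
  case (step v w)
  from step.hyps(2) have "derives1 G (p @ v @ q) (p @ w @ q)"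
    unfolding derives1_def by (metis append.assoc)
  with step.IH show ?case by simp
qed simp

lemma gen_imp_derives: "gen (productions G) ss w \<Longrightarrow> (derives1 G)\<^sup>*\<^sup>* ss (map Tm w)"
proof (induction rule: gen.induct)
  case (Tm ss w t)
  then show ?case using derives_context[of G ss "map Tm w" "[Tm t]" "[]"] by simp
next
  case (Nt A r v ss w)
  have "derives1 G (Nt A # ss) (r @ ss)"
    unfolding derives1_def using Nt.hyps(1) by (intro exI[of _ "[]"] exI[of _ ss]) auto
  also have "(derives1 G)\<^sup>*\<^sup>* (r @ ss) (map Tm v @ ss)"
    using derives_context[OF Nt.IH(1), of "[]" ss] by simp
  also have "(derives1 G)\<^sup>*\<^sup>* (map Tm v @ ss) (map Tm (v @ w))"
    using derives_context[OF Nt.IH(2), of "map Tm v" "[]"] by simp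
  finally show ?case .
qed simp

text \<open>The induction runs backwards from the terminal word, which generates itself. Undoing a
  rewriting step gathers the factor generated by \<open>r\<close> under the nonterminal
  \<open>A\<close>.\<close>

lemma derives_imp_gen: "(derives1 G)\<^sup>*\<^sup>* ss (map Tm w) \<Longrightarrow> gen (productions G) ss w"
proof (induction rule: converse_rtranclp_induct)
  case base
  show ?case by (rule gen_terminals)
next
  case (step u v)
  then obtain p q A r where *: "(A, r) \<in> productions G" "u = p @ [Nt A] @ q" "v = p @ r @ q"
    by (auto simp: derives1_def)
  with step.IH show ?case by (auto elim!: gen_appendE intro!: gen_append intro: gen.Nt)
qed

lemma cfg_lang_gen: "cfg_lang G = {w \<in> lists (terminals G). gen (productions G) [Nt (start G)] w}"
  unfolding cfg_lang_def by (auto intro: gen_imp_derives derives_imp_gen)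

section \<open>Renaming of nonterminals\<close>

lemma gen_map:
  assumes "gen P ss w" "\<And>A r. (A, r) \<in> P \<Longrightarrow> (f A, map (map_symb f id) r) \<in> P'"
  shows "gen P' (map (map_symb f id) ss) w"
  using assms(1)
proof (induction rule: gen.induct)
  case (Nt A r v ss w)
  from gen.Nt[OF assms(2)[OF Nt.hyps(1)] Nt.IH] show ?case by simp
qed (auto intro: gen.intros)

text \<open>A renaming can be undone if productions of \<open>P'\<close> at renamed nonterminals of
  \<open>N\<close> all come from \<open>P\<close>. In the applications this follows from injectivity
  of \<open>f\<close> on \<open>N\<close>. The membership in \<open>lists\<close> only keeps
  nonterminals inside \<open>N\<close>; terminals are arbitrary.\<close>

lemma gen_unmap:
  assumes "gen P' (map (map_symb f id) ss) w" "ss \<in> lists (Nt ` N \<union> range Tm)"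
    and "\<And>A r. A \<in> N \<Longrightarrow> (f A, r) \<in> P' \<Longrightarrow>
      \<exists>r'. (A, r') \<in> P \<and> r = map (map_symb f id) r' \<and> r' \<in> lists (Nt ` N \<union> range Tm)"
  shows "gen P ss w"
  using assms(1,2)
proof (induction "map (map_symb f id) ss" w arbitrary: ss rule: gen.induct)
  case Nil
  then show ?case by (auto intro: gen.Nil)
next
  case (Tm xs w t)
  then show ?case by (cases ss; cases "hd ss") (auto intro: gen.Tm)
next
  case (Nt B r v xs w)
  then obtain A ss' where ss: "ss = symb.Nt A # ss'" "B = f A" "A \<in> N"
      "xs = map (map_symb f id) ss'" "ss' \<in> lists (symb.Nt ` N \<union> range symb.Tm)"
    by (cases ss; cases "hd ss") auto
  obtain r' where "(A, r') \<in> P" "r = map (map_symb f id) r'"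
      "r' \<in> lists (symb.Nt ` N \<union> range symb.Tm)"
    using assms(3) ss Nt.hyps(1) by blast
  with Nt ss show ?case by (auto intro: gen.Nt)
qed

section \<open>Closure properties of context-free languages\<close>

text \<open>Later grammars have tagged numbers or triples as nonterminals, whereas
  \<open>context_free_over\<close> asks for natural numbers; a finite set of nonterminals embeds
  into them.\<close>

lemma context_free_overI:
  fixes G :: "('n, 't) cfg"
  assumes "wf_cfg G"
  shows "context_free_over (terminals G) (cfg_lang G)"
proof -
  from assms have "finite (nonterminals G)" by (simp add: wf_cfg_def)
  then obtain f :: "'n \<Rightarrow> nat" where f: "inj_on f (nonterminals G)"
    using finite_imp_inj_to_nat_seg by blast
  let ?h = "map (map_symb f id)"
  define G' where "G' = \<lparr>nonterminals = f ` nonterminals G, terminals = terminals G,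
    productions = map_prod f ?h ` productions G, start = f (start G)\<rparr>"
  have prod: "A \<in> nonterminals G" "r \<in> lists (Nt ` nonterminals G \<union> Tm ` terminals G)"
    if "(A, r) \<in> productions G" for A r
    using that assms by (auto simp: wf_cfg_def)
  have map: "?h r \<in> lists (Nt ` f ` nonterminals G \<union> Tm ` terminals G)"
    if "(A, r) \<in> productions G" for A r
    using prod(2)[OF that] by (induction r) auto
  have "wf_cfg G'"
    using assms prod(1) map by (force simp: wf_cfg_def G'_def)
  moreover have "cfg_lang G' = cfg_lang G"
  proof -
    have "gen (productions G') [Nt (f (start G))] w \<longleftrightarrow> gen (productions G) [Nt (start G)] w" for w
    proof
      assume "gen (productions G) [Nt (start G)] w"
      from gen_map[OF this, of f "productions G'"]
      show "gen (productions G') [Nt (f (start G))] w"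
        by (force simp: G'_def)
    next
      assume "gen (productions G') [Nt (f (start G))] w"
      then have "gen (productions G') (?h [Nt (start G)]) w" by simp
      then show "gen (productions G) [Nt (start G)] w"
      proof (rule gen_unmap[where N = "nonterminals G"])
        show "[Nt (start G)] \<in> lists (Nt ` nonterminals G \<union> range Tm)"
          using assms by (auto simp: wf_cfg_def)
        fix A r assume "A \<in> nonterminals G" "(f A, r) \<in> productions G'"
        then obtain r' where r': "(A, r') \<in> productions G" "r = ?h r'"
          using prod(1) f by (auto simp: G'_def dest: inj_onD)
        moreover have "r' \<in> lists (Nt ` nonterminals G \<union> range Tm)"
          using prod(2)[OF r'(1)] by auto
        ultimately show "\<exists>r'. (A, r') \<in> productions G \<and> r = ?h r' \<and>
            r' \<in> lists (Nt ` nonterminals G \<union> range Tm)" by blast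
      qed
    qed
    then show ?thesis by (simp add: cfg_lang_gen G'_def)
  qed
  ultimately show ?thesis
    unfolding context_free_over_def by (intro exI[of _ G']) (simp add: G'_def)
qed

lemma context_free_over_Un:
  assumes "context_free_over \<Sigma> K" "context_free_over \<Sigma> L"
  shows "context_free_over \<Sigma> (K \<union> L)"
proof -
  from assms obtain G H :: "(nat, 'a) cfg" where
    G: "wf_cfg G" "terminals G = \<Sigma>" "K = cfg_lang G" and
    H: "wf_cfg H" "terminals H = \<Sigma>" "L = cfg_lang H"
    unfolding context_free_over_def by blast
  \<comment> \<open>Indexing the two grammars by a truth value lets one argument serve both. The tag
    \<open>b\<close> keeps their nonterminals apart, and \<open>None\<close> is the fresh start
    symbol.\<close>
  define C where "C b = (if b then G else H)" for b
  have C: "wf_cfg (C b)" "terminals (C b) = \<Sigma>" for b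
    using G H by (auto simp: C_def)
  let ?f = "\<lambda>b A. Some (b :: bool, A :: nat)"
  let ?h = "\<lambda>b. map (map_symb (?f b) id)"
  define U where "U = \<lparr>nonterminals = insert None (\<Union>b. ?f b ` nonterminals (C b)),
    terminals = \<Sigma>,
    productions = range (\<lambda>b. (None, [Nt (?f b (start (C b)))])) \<union>
      (\<Union>b. map_prod (?f b) (?h b) ` productions (C b)), start = None\<rparr>"
  have prod: "A \<in> nonterminals (C b)"
      "r \<in> lists (Nt ` nonterminals (C b) \<union> Tm ` \<Sigma>)"
    if "(A, r) \<in> productions (C b)" for A r b
    using that C[of b] by (auto simp: wf_cfg_def)
  have map: "?h b r \<in> lists (Nt ` nonterminals U \<union> Tm ` \<Sigma>)"
    if "(A, r) \<in> productions (C b)" for A r b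
    proof -
    have "Nt (?f b B) \<in> Nt ` nonterminals U" if "B \<in> nonterminals (C b)" for B
      using that by (auto simp: U_def)
    with prod(2)[OF that] show ?thesis by (induction r) auto
  qed
  have fin: "finite (nonterminals (C b))" "finite (productions (C b))" "finite \<Sigma>"
    "start (C b) \<in> nonterminals (C b)" for b
    using C[of b] by (auto simp: wf_cfg_def)
  have "productions U \<subseteq> nonterminals U \<times> lists (Nt ` nonterminals U \<union> Tm ` \<Sigma>)"
  proof (intro subsetI)
    fix x assume "x \<in> productions U"
    then consider b where "x = (None, [Nt (?f b (start (C b)))])"
      | b A r where "x = (?f b A, ?h b r)" "(A, r) \<in> productions (C b)"
      by (auto simp: U_def)
    then show "x \<in> nonterminals U \<times> lists (Nt ` nonterminals U \<union> Tm ` \<Sigma>)"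
    proof cases
      case 1
      then show ?thesis using fin(4)[of b] by (auto simp: U_def)
    next
      case 2
      then show ?thesis using prod(1)[OF 2(2)] map[OF 2(2)] by (auto simp: U_def)
    qed
  qed
  then have wf: "wf_cfg U"
    using fin by (simp add: wf_cfg_def) (simp add: U_def)
  have gen: "gen (productions U) [Nt (?f b (start (C b)))] w
      \<longleftrightarrow> gen (productions (C b)) [Nt (start (C b))] w" for b w
  proof
    assume "gen (productions (C b)) [Nt (start (C b))] w"
    from gen_map[OF this, of "?f b" "productions U"]
    show "gen (productions U) [Nt (?f b (start (C b)))] w"
      by (force simp: U_def)
  next
    assume "gen (productions U) [Nt (?f b (start (C b)))] w"
    then have "gen (productions U) (?h b [Nt (start (C b))]) w" by simp
    then show "gen (productions (C b)) [Nt (start (C b))] w"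
    proof (rule gen_unmap[where N = "nonterminals (C b)"])
      show "[Nt (start (C b))] \<in> lists (Nt ` nonterminals (C b) \<union> range Tm)"
        using fin by auto
      fix A r assume "A \<in> nonterminals (C b)" "(?f b A, r) \<in> productions U"
      then obtain r' where r': "(A, r') \<in> productions (C b)" "r = ?h b r'"
        by (auto simp: U_def)
      moreover have "r' \<in> lists (Nt ` nonterminals (C b) \<union> range Tm)"
        using prod(2)[OF r'(1)] by auto
      ultimately show "\<exists>r'. (A, r') \<in> productions (C b) \<and> r = ?h b r' \<and>
          r' \<in> lists (Nt ` nonterminals (C b) \<union> range Tm)" by blast
    qed
  qed
  have start: "(None, r) \<in> productions U \<longleftrightarrow> (\<exists>b. r = [Nt (?f b (start (C b)))])" for r
    by (auto simp: U_def)
  have "gen (productions U) [Nt (start U)] w \<longleftrightarrow>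
      (\<exists>b. gen (productions (C b)) [Nt (start (C b))] w)" for w
    using start gen[of _ w] by (subst gen_Nt_single) (auto simp: U_def)
  then have "cfg_lang U = K \<union> L"
    unfolding cfg_lang_gen G(3) H(3) by (auto simp: ex_bool_eq C_def G H U_def)
  with context_free_overI[OF wf] show ?thesis by (simp add: U_def)
qed

lemma vimage_rev: "rev -` L = rev ` L"
proof
  show "rev -` L \<subseteq> rev ` L"
  proof
    fix w assume "w \<in> rev -` L"
    then have "rev w \<in> L" by simp
    then show "w \<in> rev ` L" by (rule rev_image_eqI) simp
  qed
qed auto

section \<open>Reversal of grammars\<close>

lemma gen_rev: "gen P ss w \<Longrightarrow> gen (apsnd rev ` P) (rev ss) (rev w)"
proof (induction rule: gen.induct)
  case (Tm ss w t)
  then show ?case using gen_append[OF _ gen_terminals[of _ "[t]"]] by force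
next
  case (Nt A r v ss w)
  from Nt.hyps(1) have "(A, rev r) \<in> apsnd rev ` P" by force
  with Nt.IH(1) have "gen (apsnd rev ` P) [symb.Nt A] (rev v)"
    by (auto simp: gen_Nt_single)
  with Nt.IH(2) show ?case by (simp add: gen_append)
qed (simp add: gen.Nil)

lemma context_free_over_rev:
  assumes "context_free_over \<Sigma> L"
  shows "context_free_over \<Sigma> (rev ` L)"
proof -
  from assms obtain G :: "(nat, 'a) cfg" where
    G: "wf_cfg G" "terminals G = \<Sigma>" "L = cfg_lang G"
    unfolding context_free_over_def by blast
  let ?P = "productions G"
  let ?G = "G\<lparr>productions := apsnd rev ` ?P\<rparr>"
  have "wf_cfg ?G"
    using G(1) by (fastforce simp: wf_cfg_def)
  moreover have "cfg_lang ?G = rev ` L"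
  proof -
    \<comment> \<open>Reversing right-hand sides is an involution, so the one implication
      \<open>gen_rev\<close>, applied to both grammars, yields an equivalence.\<close>
    have invol: "apsnd rev ` apsnd rev ` ?P = ?P"
      by (force simp: image_image apsnd_def map_prod_def)
    have "gen (apsnd rev ` ?P) [Nt (start G)] w \<longleftrightarrow> gen ?P [Nt (start G)] (rev w)" for w
      using gen_rev[of ?P "[Nt (start G)]" "rev w"]
        gen_rev[of "apsnd rev ` ?P" "[Nt (start G)]" w] by (auto simp: invol)
    then have "w \<in> cfg_lang ?G \<longleftrightarrow> rev w \<in> L" for w
      by (simp add: cfg_lang_gen G(3) in_lists_conv_set)
    then have "cfg_lang ?G = rev -` L" by blast
    also have "\<dots> = rev ` L" by (rule vimage_rev)
    finally show ?thesis .
  qed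
  ultimately show ?thesis
    using context_free_overI[of ?G] G(2) by simp
qed

section \<open>Pushdown automata\<close>

type_synonym ('q, 't, 'g) pda = "('q \<times> 't list \<times> 'g \<times> 'q \<times> 'g list) set"

text \<open>A transition pops one symbol and may read any word, the empty one being a silent move.
  Acceptance demands the state \<open>f\<close>, exhausted input and an empty stack all at
  once.\<close>

inductive accepts :: "('q, 't, 'g) pda \<Rightarrow> 'q \<Rightarrow> 'q \<Rightarrow> 't list \<Rightarrow> 'g list \<Rightarrow> bool"
  for \<delta> f where
  empty: "accepts \<delta> f f [] []"
| step: "(q, t, Z, q', \<beta>) \<in> \<delta> \<Longrightarrow> accepts \<delta> f q' w (\<beta> @ \<gamma>) \<Longrightarrow> accepts \<delta> f q (t @ w) (Z # \<gamma>)"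

lemma accepts_Nil_iff: "accepts \<delta> f q w [] \<longleftrightarrow> q = f \<and> w = []"
  by (subst accepts.simps) auto

lemma accepts_Cons_iff:
  "accepts \<delta> f q w (Z # \<gamma>) \<longleftrightarrow>
     (\<exists>t v q' \<beta>. w = t @ v \<and> (q, t, Z, q', \<beta>) \<in> \<delta> \<and> accepts \<delta> f q' v (\<beta> @ \<gamma>))"
  by (subst accepts.simps) blast

text \<open>The nonterminal \<open>(q, Z, p)\<close> generates the words read while passing from \<open>q\<close> to \<open>p\<close> and
  removing \<open>Z\<close> from the stack; a chain does the same for a whole stack, guessing the
  intermediate states.\<close>

fun chain :: "'q set \<Rightarrow> 'q \<Rightarrow> 'g list \<Rightarrow> 'q \<Rightarrow> ('q \<times> 'g \<times> 'q, 't) symb list set" where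
  "chain Q q [] p = (if q = p then {[]} else {})"
| "chain Q q (Y # \<gamma>) p = (\<Union>r\<in>Q. (#) (Nt (q, Y, r)) ` chain Q r \<gamma> p)"

definition triple_productions ::
  "'q set \<Rightarrow> ('q, 't, 'g) pda \<Rightarrow> (('q \<times> 'g \<times> 'q) \<times> ('q \<times> 'g \<times> 'q, 't) symb list) set" where
  "triple_productions Q \<delta> = (\<Union>(q, t, Z, q', \<beta>)\<in>\<delta>. \<Union>p\<in>Q. (\<lambda>x. ((q, Z, p), map Tm t @ x)) ` chain Q q' \<beta> p)"

lemma finite_chain: "finite Q \<Longrightarrow> finite (chain Q q \<gamma> p)"
  by (induction \<gamma> arbitrary: q) auto

lemma chain_lists:
  "ss \<in> chain Q q \<gamma> p \<Longrightarrow> q \<in> Q \<Longrightarrow> \<gamma> \<in> lists \<Gamma> \<Longrightarrow> ss \<in> lists (Nt ` (Q \<times> \<Gamma> \<times> Q))"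
  by (induction \<gamma> arbitrary: q ss) (fastforce split: if_splits)+

lemma chain_append:
  assumes "ss \<in> chain Q q (\<beta> @ \<gamma>) p" "q \<in> Q"
  shows "\<exists>r\<in>Q. \<exists>x\<in>chain Q q \<beta> r. \<exists>y\<in>chain Q r \<gamma> p. ss = x @ y"
  using assms
proof (induction \<beta> arbitrary: q ss)
  case (Cons Y \<beta>)
  then obtain q' ss' where *: "q' \<in> Q" "ss = Nt (q, Y, q') # ss'" "ss' \<in> chain Q q' (\<beta> @ \<gamma>) p"
    by auto
  with Cons.IH[of ss' q'] show ?case by fastforce
qed simp

text \<open>The form \<open>map Tm t @ x\<close> covers right-hand sides whose terminals are partly
  consumed, as the induction requires. Quantifying over \<open>w'\<close> and
  \<open>\<gamma>\<close> says that the run never looks below \<open>\<beta>\<close> and can be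
  followed by any accepting continuation.\<close>

lemma gen_triple_imp_accepts:
  assumes "gen (triple_productions Q \<delta>) ss w" "ss = map Tm t @ x" "x \<in> chain Q q \<beta> p"
  shows "\<exists>v. w = t @ v \<and> (\<forall>w' \<gamma>. accepts \<delta> f p w' \<gamma> \<longrightarrow> accepts \<delta> f q (v @ w') (\<beta> @ \<gamma>))"
  using assms
proof (induction arbitrary: t x q \<beta> p rule: gen.induct)
  case Nil
  then show ?case by (cases \<beta>) (auto split: if_splits)
next
  case (Tm ss w a)
  from Tm.prems obtain t' where t: "t = a # t'" "ss = map symb.Tm t' @ x"
    by (cases t; cases \<beta>) (auto split: if_splits)
  from Tm.IH[OF t(2) Tm.prems(2)] t(1) show ?case by auto
next
  case (Nt A r v ss w)
  from Nt.prems obtain Y \<beta>' q1 x' where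
    1: "t = []" "\<beta> = Y # \<beta>'" "A = (q, Y, q1)" "ss = x'" "x' \<in> chain Q q1 \<beta>' p"
    by (cases t; cases \<beta>) (auto split: if_splits)
  \<comment> \<open>The production comes from a transition that pops \<open>Y\<close>. The first
    induction hypothesis supplies the run from there down to \<open>q1\<close>, the second the
    removal of the remaining symbols.\<close>
  from Nt.hyps(1) 1(3) obtain t0 q' \<beta>0 y where
    2: "(q, t0, Y, q', \<beta>0) \<in> \<delta>" "r = map symb.Tm t0 @ y" "y \<in> chain Q q' \<beta>0 q1"
    by (auto simp: triple_productions_def)
  from Nt.IH(1)[OF 2(2,3)] obtain v0 where
    3: "v = t0 @ v0" "\<And>w' \<gamma>. accepts \<delta> f q1 w' \<gamma> \<Longrightarrow> accepts \<delta> f q' (v0 @ w') (\<beta>0 @ \<gamma>)"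
    by blast
  from Nt.IH(2)[of "[]" x'] 1 have
    4: "\<And>w' \<gamma>. accepts \<delta> f p w' \<gamma> \<Longrightarrow> accepts \<delta> f q1 (w @ w') (\<beta>' @ \<gamma>)"
    by fastforce
  have "accepts \<delta> f q (t0 @ (v0 @ w @ w')) (Y # \<beta>' @ \<gamma>)" if "accepts \<delta> f p w' \<gamma>" for w' \<gamma>
    by (rule accepts.step[OF 2(1) 3(2)[OF 4[OF that]]])
  with 1 3(1) show ?case by auto
qed

text \<open>After a transition, the chain for \<open>\<beta> @ \<gamma>\<close> is cut at the state
  \<open>r\<close> in which \<open>\<beta>\<close> has vanished; this state is the third component
  of the nonterminal for the popped symbol.\<close>

lemma accepts_imp_gen_triple:
  assumes "accepts \<delta> f q w \<gamma>" "\<delta> \<subseteq> Q \<times> UNIV \<times> UNIV \<times> Q \<times> UNIV"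
  shows "\<exists>ss\<in>chain Q q \<gamma> f. gen (triple_productions Q \<delta>) ss w"
  using assms(1)
proof (induction rule: accepts.induct)
  case empty
  show ?case by (auto intro: gen.Nil)
next
  case (step q t Z q' \<beta> w \<gamma>)
  from step.hyps(1) assms(2) have "q' \<in> Q" by auto
  from step.IH obtain ss where ss: "ss \<in> chain Q q' (\<beta> @ \<gamma>) f" "gen (triple_productions Q \<delta>) ss w"
    by blast
  from chain_append[OF ss(1) \<open>q' \<in> Q\<close>] obtain r x y where
    r: "r \<in> Q" "x \<in> chain Q q' \<beta> r" "y \<in> chain Q r \<gamma> f" "ss = x @ y" by blast
  with ss(2) obtain v v' where v: "w = v @ v'" "gen (triple_productions Q \<delta>) x v"
    "gen (triple_productions Q \<delta>) y v'" by (auto elim: gen_appendE)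
  have "((q, Z, r), map Tm t @ x) \<in> triple_productions Q \<delta>"
    using step.hyps(1) r(1,2) by (fastforce simp: triple_productions_def)
  from gen.Nt[OF this gen_append[OF gen_terminals v(2)] v(3)]
  have "gen (triple_productions Q \<delta>) (Nt (q, Z, r) # y) (t @ w)" by (simp add: v(1))
  with r show ?case by (intro bexI[of _ "Nt (q, Z, r) # y"]) auto
qed

theorem context_free_over_pda:
  assumes fin: "finite Q" "finite \<Sigma>" "finite \<Gamma>" "finite \<delta>"
    and \<delta>: "\<delta> \<subseteq> Q \<times> lists \<Sigma> \<times> \<Gamma> \<times> Q \<times> lists \<Gamma>"
    and start: "q \<in> Q" "Z \<in> \<Gamma>" "f \<in> Q"
  shows "context_free_over \<Sigma> {w \<in> lists \<Sigma>. accepts \<delta> f q w [Z]}"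
proof -
  let ?P = "triple_productions Q \<delta>"
  let ?N = "Q \<times> \<Gamma> \<times> Q"
  let ?G = "\<lparr>nonterminals = ?N, terminals = \<Sigma>, productions = ?P, start = (q, Z, f)\<rparr>"
  have "?P \<subseteq> ?N \<times> lists (Nt ` ?N \<union> Tm ` \<Sigma>)"
  proof (intro subsetI)
    fix y assume "y \<in> ?P"
    then obtain q1 t Y q' \<beta> p x where *: "(q1, t, Y, q', \<beta>) \<in> \<delta>" "p \<in> Q" "x \<in> chain Q q' \<beta> p"
      "y = ((q1, Y, p), map Tm t @ x)" by (auto simp: triple_productions_def)
    from *(1) \<delta> have mem: "q1 \<in> Q" "t \<in> lists \<Sigma>" "Y \<in> \<Gamma>" "q' \<in> Q" "\<beta> \<in> lists \<Gamma>" by auto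
    from chain_lists[OF *(3) mem(4,5)] have "x \<in> lists (Nt ` ?N \<union> Tm ` \<Sigma>)" by auto
    with * mem show "y \<in> ?N \<times> lists (Nt ` ?N \<union> Tm ` \<Sigma>)" by auto
  qed
  moreover have "finite ?P"
    unfolding triple_productions_def using fin by (auto intro!: finite_chain)
  ultimately have "wf_cfg ?G"
    using fin start by (simp add: wf_cfg_def)
  moreover have "cfg_lang ?G = {w \<in> lists \<Sigma>. accepts \<delta> f q w [Z]}"
  proof -
    have "accepts \<delta> f q w [Z]" if "gen ?P [Nt (q, Z, f)] w" for w
      using gen_triple_imp_accepts[OF that, of "[]" "[Nt (q, Z, f)]" q "[Z]" f f] start
        accepts.empty[of \<delta> f] by fastforce
    moreover have "gen ?P [Nt (q, Z, f)] w" if "accepts \<delta> f q w [Z]" for w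
      using accepts_imp_gen_triple[OF that, of Q] \<delta> by (fastforce split: if_splits)
    ultimately show ?thesis by (auto simp: cfg_lang_gen)
  qed
  ultimately show ?thesis using context_free_overI[of ?G] by simp
qed

text \<open>A deterministic automaton becomes a pushdown automaton that keeps its only stack symbol
  while reading. A silent move from a state of \<open>F\<close> pops the symbol and enters the added
  state \<open>None\<close>.\<close>

lemma context_free_over_automaton:
  assumes "finite Q" "finite \<Sigma>" "q \<in> Q" "\<And>p a. p \<in> Q \<Longrightarrow> a \<in> \<Sigma> \<Longrightarrow> nxt p a \<in> Q"
  shows "context_free_over \<Sigma> {w \<in> lists \<Sigma>. foldl nxt q w \<in> F}"
proof -
  define \<delta> where "\<delta> = (\<lambda>(p, a). (Some p, [a], (), Some (nxt p a), [()])) ` (Q \<times> \<Sigma>) \<union>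
    (\<lambda>p. (Some p, [], (), None, [])) ` (Q \<inter> F)"
  have read: "(Some p, t, (), p', \<beta>) \<in> \<delta> \<longleftrightarrow>
      p \<in> Q \<and> (\<exists>a\<in>\<Sigma>. t = [a] \<and> p' = Some (nxt p a) \<and> \<beta> = [()]) \<or>
      p \<in> Q \<inter> F \<and> t = [] \<and> p' = None \<and> \<beta> = []" for p t p' \<beta>
    by (auto simp: \<delta>_def)
  have "accepts \<delta> None (Some p) w [()] \<longleftrightarrow> foldl nxt p w \<in> F"
    if "p \<in> Q" "w \<in> lists \<Sigma>" for p w
    using that
  proof (induction w arbitrary: p)
    case Nil
    then show ?case by (subst accepts_Cons_iff) (auto simp: read accepts_Nil_iff)
  next
    case (Cons a w)
    have "accepts \<delta> None (Some p) (a # w) [()] \<longleftrightarrow>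
        accepts \<delta> None (Some (nxt p a)) w [()]" (is "?L \<longleftrightarrow> ?R")
    proof
      assume ?L
      then show ?R by (subst (asm) accepts_Cons_iff) (auto simp: read accepts_Nil_iff)
    next
      assume ?R
      moreover have "(Some p, [a], (), Some (nxt p a), [()]) \<in> \<delta>"
        using Cons.prems by (simp add: read)
      ultimately show ?L using accepts.step[of "Some p" "[a]" "()" _ "[()]" \<delta> None w "[]"] by simp
    qed
    with Cons show ?case by (simp add: assms(4))
  qed
  then have "{w \<in> lists \<Sigma>. foldl nxt q w \<in> F} = {w \<in> lists \<Sigma>. accepts \<delta> None (Some q) w [()]}"
    using assms(3) by auto
  also have "context_free_over \<Sigma> \<dots>"
    by (rule context_free_over_pda[where Q = "insert None (Some ` Q)" and \<Gamma> = "{()}"])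
      (use assms in \<open>auto simp: \<delta>_def\<close>)
  finally show ?thesis .
qed

section \<open>Reduction in the free group\<close>

abbreviation inv_word :: "'a letter list \<Rightarrow> 'a letter list" where
  "inv_word w \<equiv> map inv_letter (rev w)"

lemma reduce_inverse_right: "reduce (w @ inv_word w) = []"
  using reduce_inverse[of "inv_word w"] by (simp add: rev_map comp_def)

lemma reduce_cancel_right: "reduce (u @ w) = reduce (v @ w) \<longleftrightarrow> reduce u = reduce v"
proof
  have cancel: "reduce (reduce (x @ w) @ inv_word w) = reduce x" for x
    using reduce_append_right[of x "w @ inv_word w"] by (simp add: reduce_inverse_right)
  assume "reduce (u @ w) = reduce (v @ w)"
  with cancel[of u] cancel[of v] show "reduce u = reduce v" by simp
next
  assume "reduce u = reduce v"
  then show "reduce (u @ w) = reduce (v @ w)" by (metis reduce_append_left)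
qed

lemma reduce_cancel_left: "reduce (w @ u) = reduce (w @ v) \<longleftrightarrow> reduce u = reduce v"
proof
  have cancel: "reduce (inv_word w @ reduce (w @ x)) = reduce x" for x
    using reduce_append_left[of "inv_word w @ w" x] by (simp add: reduce_inverse)
  assume "reduce (w @ u) = reduce (w @ v)"
  with cancel[of u] cancel[of v] show "reduce u = reduce v" by simp
next
  assume "reduce u = reduce v"
  then show "reduce (w @ u) = reduce (w @ v)" by (metis reduce_append_right)
qed

lemma reduce_append_inverse: "reduce (u @ inv_word v) = [] \<longleftrightarrow> reduce u = reduce v"
  using reduce_cancel_right[of u "inv_word v" v] by (simp add: reduce_inverse_right)

section \<open>Reduced words extended on the right\<close>

lemma reduced_appendD: "reduced (u @ v) \<Longrightarrow> reduced u"
  by (simp add: reduced_def successively_append_iff)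

lemma reduced_snoc:
  "reduced (g @ [a]) \<longleftrightarrow> reduced g \<and> (g = [] \<or> last g \<noteq> inv_letter a)"
  by (auto simp: reduced_def successively_append_iff)

text \<open>\<open>push\<close> adds letters on the left, but a walk in the Cayley graph multiplies
  on the right. Either the new letter cancels the last one, or the longer word is already
  reduced.\<close>

lemma reduce_snoc:
  assumes "reduced g"
  shows "reduce (g @ [a]) = (if g \<noteq> [] \<and> last g = inv_letter a then butlast g else g @ [a])"
proof (cases "g \<noteq> [] \<and> last g = inv_letter a")
  case True
  then have g: "g = butlast g @ [inv_letter a]" by (metis append_butlast_last_id)
  then have "reduced (butlast g)" using assms reduced_appendD by metis
  moreover have "reduce (butlast g @ [inv_letter a] @ [a]) = reduce (butlast g @ [])"
    by (subst reduce_cancel_left) (simp add: reduce_def)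
  ultimately have "reduce (g @ [a]) = butlast g" by (subst g) simp
  with True show ?thesis by simp
next
  case False
  with assms show ?thesis by (auto simp: reduced_snoc)
qed

section \<open>Munn trees are determined by their vertices\<close>

definition visited :: "'a letter list \<Rightarrow> 'a letter list set" where
  "visited w = {reduce (take i w) | i. i \<le> length w}"

text \<open>With the Cayley graph seen as a tree rooted at the empty word, this is the edge from a
  vertex other than the root to its parent \<open>butlast h\<close>.\<close>

definition tree_edge :: "'a letter list \<Rightarrow> 'a cayley_edge" where
  "tree_edge h = read_edge (butlast h) (last h)"

lemma visited_conv: "visited w = {reduce p | p r. w = p @ r}"
proof -
  have "visited w = {reduce (take i w) | i. True}"
    unfolding visited_def by (metis nat_le_linear order_refl take_all)
  also have "\<dots> = {reduce p | p r. w = p @ r}"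
    by (metis append_eq_conv_conj append_take_drop_id)
  finally show ?thesis .
qed

lemma visited_Nil: "visited [] = {[]}"
  by (simp add: visited_def reduce_def)

lemma visited_snoc: "visited (w @ [a]) = insert (reduce (w @ [a])) (visited w)"
proof -
  have "(\<exists>r. w @ [a] = p @ r) \<longleftrightarrow> p = w @ [a] \<or> (\<exists>r. w = p @ r)" for p
    by (metis append.assoc append.right_neutral butlast_append butlast_snoc)
  then show ?thesis by (auto simp: visited_conv)
qed

lemma reduce_in_visited: "reduce w \<in> visited w"
  by (auto simp: visited_def intro: exI[of _ "length w"])

text \<open>The walk starts at the root and each step leads to the parent or to a child of the
  current vertex. A new vertex is therefore only entered from its parent, and the visited set is
  closed under prefixes.\<close>

lemma butlast_in_visited: "h \<in> visited w \<Longrightarrow> h \<noteq> [] \<Longrightarrow> butlast h \<in> visited w"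
proof (induction w arbitrary: h rule: rev_induct)
  case (snoc a w)
  have "butlast (reduce (w @ [a])) \<in> visited (w @ [a])" if "reduce (w @ [a]) \<noteq> []"
  proof -
    have "reduce (w @ [a]) = butlast (reduce w) \<or> reduce (w @ [a]) = reduce w @ [a]"
      using reduce_snoc[of "reduce w" a] by (auto split: if_splits)
    then show ?thesis
    proof
      assume *: "reduce (w @ [a]) = butlast (reduce w)"
      with that have "reduce w \<noteq> []" by auto
      with snoc.IH[OF reduce_in_visited] * have "reduce (w @ [a]) \<in> visited w" by simp
      with snoc.IH that show ?thesis by (simp add: visited_snoc)
    next
      assume "reduce (w @ [a]) = reduce w @ [a]"
      then show ?thesis using reduce_in_visited[of w] by (simp add: visited_snoc)
    qed
  qed
  with snoc show ?case by (auto simp: visited_snoc)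
qed (simp add: visited_Nil)

text \<open>Whichever way an edge is traversed, it is the parent edge of the longer of its two
  ends.\<close>

lemma read_edge_conv_tree_edge:
  assumes "reduced g"
  shows "read_edge g a = tree_edge (if g \<noteq> [] \<and> last g = inv_letter a then g else g @ [a])"
proof (cases "g \<noteq> [] \<and> last g = inv_letter a")
  case True
  then have "g = butlast g @ [inv_letter a]" by (metis append_butlast_last_id)
  with assms have "reduce (g @ [a]) = butlast g" "reduce (butlast g @ [inv_letter a]) = g"
    using True by (auto simp: reduce_snoc)
  with True show ?thesis by (cases a) (auto simp: tree_edge_def)
qed (auto simp: tree_edge_def)

text \<open>This is why the vertices determine the edges of a Munn tree. A step to the parent
  repeats an edge already present, and a step to a child inserts that child with its parent
  edge.\<close>

lemma munn_edges:
  "{read_edge (reduce (take i w)) (w ! i) | i. i < length w} = tree_edge ` (visited w - {[]})"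
    (is "?E w = _")
proof (induction w rule: rev_induct)
  case (snoc a w)
  have "?E (w @ [a]) = insert (read_edge (reduce w) a) (?E w)"
  proof -
    have image: "?E v = (\<lambda>i. read_edge (reduce (take i v)) (v ! i)) ` {..<length v}" for v :: "'a letter list"
      by auto
    show ?thesis
      unfolding image by (simp add: lessThan_Suc nth_append cong: image_cong_simp)
  qed
  also have "\<dots> = tree_edge ` (visited (w @ [a]) - {[]})"
  proof (cases "reduce w \<noteq> [] \<and> last (reduce w) = inv_letter a")
    case True
    then have "reduce (w @ [a]) = butlast (reduce w)"
      using reduce_snoc[of "reduce w" a] by simp
    then have "visited (w @ [a]) = visited w"
      using True butlast_in_visited[OF reduce_in_visited] by (auto simp: visited_snoc)
    with True show ?thesis
      using reduce_in_visited[of w] snoc by (simp add: read_edge_conv_tree_edge insert_absorb)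
  next
    case False
    then have "reduce (w @ [a]) = reduce w @ [a]"
      using reduce_snoc[of "reduce w" a] by auto
    with False show ?thesis
      using snoc by (auto simp: read_edge_conv_tree_edge visited_snoc insert_Diff_if)
  qed
  finally show ?case .
qed (simp add: visited_Nil)

lemma munn_tree_eq_iff: "munn_tree u = munn_tree v \<longleftrightarrow> reduce u = reduce v \<and> visited u = visited v"
  unfolding munn_tree_def munn_subtree_def munn_edges by (auto simp flip: visited_def)

definition suffix_values :: "'a letter list \<Rightarrow> 'a letter list set" where
  "suffix_values w = {reduce r | p r. w = p @ r}"

text \<open>Let \<open>g\<close> be the common value. A prefix of value \<open>p\<close> leaves a
  suffix of value \<open>r\<close> with \<open>p r = g\<close>, so by cancellation prefixes agree in
  value exactly when the complementary suffixes do.\<close>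

lemma visited_subset_iff:
  assumes "reduce u = reduce v"
  shows "visited u \<subseteq> visited v \<longleftrightarrow> suffix_values u \<subseteq> suffix_values v"
proof -
  have "reduce p = reduce q \<longleftrightarrow> reduce r = reduce t" if "u = p @ r" "v = q @ t" for p q r t
    using assms that reduce_cancel_left reduce_cancel_right by (metis reduce_append_left reduce_append_right)
  then show ?thesis
    unfolding visited_conv suffix_values_def by blast
qed

lemma munn_tree_eq_iff_suffix_values:
  "munn_tree u = munn_tree v \<longleftrightarrow> reduce u = reduce v \<and> suffix_values u = suffix_values v"
  unfolding munn_tree_eq_iff set_eq_subset
  using visited_subset_iff[of u v] visited_subset_iff[of v u] by auto

section \<open>Pushdown automata for the complement of the word problem\<close>

text \<open>The second argument is the word as it is read after the hash, so members of the word
  problem have the form \<open>hash_word u (rev v)\<close>.\<close>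

definition hash_word :: "'s list \<Rightarrow> 's list \<Rightarrow> 's option list" where
  "hash_word u s = map Some u @ [None] @ map Some s"

text \<open>The phases discard a prefix of \<open>u\<close>, read the guessed suffix, read beyond
  the hash, and empty the stack. A run started in \<open>Before\<close> takes all of
  \<open>u\<close> as the suffix.\<close>

datatype phase = Skip | Before | After | Drain

text \<open>A transition has popped \<open>Z\<close>, so \<open>Z\<close> is put back unless it
  cancels. The bottom symbol \<open>None\<close> never cancels.\<close>

definition push_sym :: "'a letter \<Rightarrow> 'a letter option \<Rightarrow> 'a letter option list" where
  "push_sym a Z = (if Z = Some (inv_letter a) then [] else [Some a, Z])"

text \<open>The stack holds a reduced word above the bottom symbol \<open>None\<close>; letters before the hash
  are pushed inverted. The set \<open>\<Theta>\<close> consists of the stack tops allowed after the hash: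
  excluding the bottom symbol forces the stack to stay nontrivial throughout.\<close>

definition munn_pda :: "'a letter set \<Rightarrow> 'a letter option set \<Rightarrow>
    (phase, 'a letter option, 'a letter option) pda" where
  "munn_pda A \<Theta> =
     (\<lambda>(a, Z). (Skip, [Some a], Z, Skip, [Z])) ` (A \<times> hash_alphabet A) \<union>
     (\<lambda>Z. (Skip, [], Z, Before, [Z])) ` hash_alphabet A \<union>
     (\<lambda>(a, Z). (Before, [Some a], Z, Before, push_sym (inv_letter a) Z)) ` (A \<times> hash_alphabet A) \<union>
     (\<lambda>Z. (Before, [None], Z, After, [Z])) ` \<Theta> \<union>
     (\<lambda>(a, Z). (After, [Some a], Z, After, push_sym a Z)) ` (A \<times> \<Theta>) \<union>
     (\<lambda>Z. (After, [], Z, Drain, [])) ` Some ` A \<union>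
     (\<lambda>Z. (Drain, [], Z, Drain, [])) ` hash_alphabet A"

section \<open>Encoded stacks and single transitions\<close>

definition stack :: "'a letter list \<Rightarrow> 'a letter option list" where
  "stack g = map Some g @ [None]"

lemma stack_not_Nil [simp]: "stack g \<noteq> []"
  by (simp add: stack_def)

lemma stack_in_lists: "g \<in> lists A \<Longrightarrow> stack g \<in> lists (hash_alphabet A)"
  by (auto simp: stack_def hash_alphabet_def)

lemma hd_stack: "g \<in> lists A \<Longrightarrow> hd (stack g) \<in> hash_alphabet A"
  by (cases g) (auto simp: stack_def hash_alphabet_def)

lemma hd_stack_Some: "g \<in> lists A \<Longrightarrow> hd (stack g) \<in> Some ` A \<longleftrightarrow> g \<noteq> []"
  by (cases g) (auto simp: stack_def)

lemma push_sym_stack: "push_sym a (hd (stack g)) @ tl (stack g) = stack (push a g)"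
  by (cases g) (auto simp: stack_def push_sym_def)

lemma munn_pda_iff:
  "(Skip, t, Z, q, \<beta>) \<in> munn_pda A \<Theta> \<longleftrightarrow> Z \<in> hash_alphabet A \<and> \<beta> = [Z] \<and>
     (q = Skip \<and> (\<exists>a\<in>A. t = [Some a]) \<or> q = Before \<and> t = [])"
  "(Before, t, Z, q, \<beta>) \<in> munn_pda A \<Theta> \<longleftrightarrow>
     Z \<in> hash_alphabet A \<and> q = Before \<and> (\<exists>a\<in>A. t = [Some a] \<and> \<beta> = push_sym (inv_letter a) Z) \<or>
     Z \<in> \<Theta> \<and> q = After \<and> t = [None] \<and> \<beta> = [Z]"
  "(After, t, Z, q, \<beta>) \<in> munn_pda A \<Theta> \<longleftrightarrow>
     Z \<in> \<Theta> \<and> q = After \<and> (\<exists>a\<in>A. t = [Some a] \<and> \<beta> = push_sym a Z) \<or>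
     Z \<in> Some ` A \<and> q = Drain \<and> t = [] \<and> \<beta> = []"
  "(Drain, t, Z, q, \<beta>) \<in> munn_pda A \<Theta> \<longleftrightarrow> Z \<in> hash_alphabet A \<and> q = Drain \<and> t = [] \<and> \<beta> = []"
  by (auto simp: munn_pda_def image_iff)

lemma accepts_munn_pda_Cons:
  "accepts (munn_pda A \<Theta>) f q w (Z # \<gamma>) \<longleftrightarrow>
     (\<exists>q' \<beta>. (q, [], Z, q', \<beta>) \<in> munn_pda A \<Theta> \<and> accepts (munn_pda A \<Theta>) f q' w (\<beta> @ \<gamma>)) \<or>
     (\<exists>x v. w = x # v \<and>
       (\<exists>q' \<beta>. (q, [x], Z, q', \<beta>) \<in> munn_pda A \<Theta> \<and> accepts (munn_pda A \<Theta>) f q' v (\<beta> @ \<gamma>)))"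
    (is "_ \<longleftrightarrow> ?R")
proof
  assume "accepts (munn_pda A \<Theta>) f q w (Z # \<gamma>)"
  then obtain t v q' \<beta> where *: "w = t @ v" "(q, t, Z, q', \<beta>) \<in> munn_pda A \<Theta>"
    "accepts (munn_pda A \<Theta>) f q' v (\<beta> @ \<gamma>)"
    by (auto simp: accepts_Cons_iff)
  from *(2) have "t = [] \<or> (\<exists>x. t = [x])" by (cases q) (auto simp: munn_pda_iff)
  with * show ?R by auto
next
  assume ?R
  then show "accepts (munn_pda A \<Theta>) f q w (Z # \<gamma>)"
    using accepts.step[of q "[]" Z] accepts.step[of q "[_]" Z] by fastforce
qed

lemma accepts_stack_iff:
  "accepts (munn_pda A \<Theta>) f q w (stack g) \<longleftrightarrow>
     (\<exists>q' \<beta>. (q, [], hd (stack g), q', \<beta>) \<in> munn_pda A \<Theta> \<and>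
       accepts (munn_pda A \<Theta>) f q' w (\<beta> @ tl (stack g))) \<or>
     (\<exists>x v. w = x # v \<and> (\<exists>q' \<beta>. (q, [x], hd (stack g), q', \<beta>) \<in> munn_pda A \<Theta> \<and>
       accepts (munn_pda A \<Theta>) f q' v (\<beta> @ tl (stack g))))"
  using accepts_munn_pda_Cons[of A \<Theta> f q w "hd (stack g)" "tl (stack g)"] by simp

lemma accepts_Drain:
  "\<gamma> \<in> lists (hash_alphabet A) \<Longrightarrow> accepts (munn_pda A \<Theta>) Drain Drain w \<gamma> \<longleftrightarrow> w = []"
proof (induction \<gamma>)
  case (Cons Z \<gamma>)
  then show ?case by (subst accepts_munn_pda_Cons) (auto simp: munn_pda_iff)
qed (simp add: accepts_Nil_iff)

text \<open>Input can only end successfully by the move to \<open>Drain\<close>, which needs a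
  letter on top. Hence the final stack must be nontrivial whatever \<open>\<Theta>\<close>
  is.\<close>

lemma accepts_After_step:
  assumes "g \<in> lists A"
  shows "accepts (munn_pda A \<Theta>) Drain After w (stack g) \<longleftrightarrow>
    w = [] \<and> g \<noteq> [] \<or>
    (\<exists>a v. w = Some a # v \<and> a \<in> A \<and> hd (stack g) \<in> \<Theta> \<and>
       accepts (munn_pda A \<Theta>) Drain After v (stack (push a g)))"
proof -
  have "tl (stack g) \<in> lists (hash_alphabet A)"
    using stack_in_lists[OF assms] by (cases "stack g") auto
  then show ?thesis
    using hd_stack_Some[OF assms]
    by (subst accepts_stack_iff)
      (auto simp: munn_pda_iff accepts_Drain simp flip: push_sym_stack)
qed

lemma accepts_Before_step:
  assumes "g \<in> lists A"
  shows "accepts (munn_pda A \<Theta>) Drain Before w (stack g) \<longleftrightarrow>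
    (\<exists>a v. w = Some a # v \<and> a \<in> A \<and>
       accepts (munn_pda A \<Theta>) Drain Before v (stack (push (inv_letter a) g))) \<or>
    (\<exists>v. w = None # v \<and> hd (stack g) \<in> \<Theta> \<and> accepts (munn_pda A \<Theta>) Drain After v (stack g))"
proof -
  have eq: "hd (stack g) # tl (stack g) = stack g" by simp
  show ?thesis
    using hd_stack[OF assms]
    by (subst accepts_stack_iff) (auto simp: munn_pda_iff eq simp flip: push_sym_stack)
qed

section \<open>Runs through whole phases\<close>

lemma accepts_Skip:
  "accepts (munn_pda A \<Theta>) Drain Skip w [None] \<longleftrightarrow>
     (\<exists>p\<in>lists A. \<exists>v. w = map Some p @ v \<and> accepts (munn_pda A \<Theta>) Drain Before v [None])"
proof (induction w)
  case Nil
  show ?case by (subst accepts_munn_pda_Cons) (auto simp: munn_pda_iff hash_alphabet_def)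
next
  case (Cons x w)
  have "accepts (munn_pda A \<Theta>) Drain Skip (x # w) [None] \<longleftrightarrow>
      accepts (munn_pda A \<Theta>) Drain Before (x # w) [None] \<or>
      (x \<in> Some ` A \<and> accepts (munn_pda A \<Theta>) Drain Skip w [None])"
    by (subst accepts_munn_pda_Cons) (auto simp: munn_pda_iff hash_alphabet_def)
  also have "\<dots> \<longleftrightarrow> (\<exists>p\<in>lists A. \<exists>v. x # w = map Some p @ v \<and>
      accepts (munn_pda A \<Theta>) Drain Before v [None])" (is "?L \<longleftrightarrow> ?R")
  proof
    assume ?L
    then show ?R
    proof
      assume "accepts (munn_pda A \<Theta>) Drain Before (x # w) [None]"
      then show ?R by (intro bexI[of _ "[]"]) auto
    next
      assume "x \<in> Some ` A \<and> accepts (munn_pda A \<Theta>) Drain Skip w [None]"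
      then obtain a p v where "x = Some a" "a \<in> A" "p \<in> lists A" "w = map Some p @ v"
        "accepts (munn_pda A \<Theta>) Drain Before v [None]" using Cons by auto
      then show ?R by (intro bexI[of _ "a # p"]) auto
    qed
  next
    assume ?R
    then obtain p v where "p \<in> lists A" "x # w = map Some p @ v"
      "accepts (munn_pda A \<Theta>) Drain Before v [None]" by blast
    with Cons show ?L by (cases p) auto
  qed
  finally show ?case .
qed

text \<open>\<open>\<Theta>\<close> is tested on the stack before each letter is read, hence after
  every proper prefix \<open>x\<close> of \<open>s\<close>. The stack after all of \<open>s\<close>
  is tested by the move to \<open>Drain\<close>.\<close>

lemma accepts_After:
  assumes "g \<in> lists A"
  shows "accepts (munn_pda A \<Theta>) Drain After w (stack g) \<longleftrightarrow>
    (\<exists>s\<in>lists A. w = map Some s \<and> foldr push (rev s) g \<noteq> [] \<and>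
      (\<forall>x y. s = x @ y \<longrightarrow> y \<noteq> [] \<longrightarrow> hd (stack (foldr push (rev x) g)) \<in> \<Theta>))"
  using assms
proof (induction w arbitrary: g)
  case Nil
  then show ?case by (subst accepts_After_step) auto
next
  case (Cons x w)
  have split: "(\<forall>x y. a # s = x @ y \<longrightarrow> y \<noteq> [] \<longrightarrow> Q x) \<longleftrightarrow>
      Q [] \<and> (\<forall>x y. s = x @ y \<longrightarrow> y \<noteq> [] \<longrightarrow> Q (a # x))" for a s and Q :: "'a letter list \<Rightarrow> bool"
    by (auto simp: Cons_eq_append_conv)
  have list: "(\<exists>s\<in>lists A. x # w = map Some s \<and> Q s) \<longleftrightarrow>
      (\<exists>a\<in>A. x = Some a \<and> (\<exists>s\<in>lists A. w = map Some s \<and> Q (a # s)))" for Q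
    by (auto simp: Cons_eq_map_conv Bex_def)
  show ?case
  proof (cases "\<exists>a\<in>A. x = Some a")
    case True
    then obtain a where a: "a \<in> A" "x = Some a" by blast
    then have "push a g \<in> lists A" using Cons.prems push_lists by blast
    note IH = Cons.IH[OF this]
    show ?thesis
      unfolding accepts_After_step[OF Cons.prems] list split
      using a by (auto simp: IH)
  next
    case False
    then show ?thesis
      unfolding accepts_After_step[OF Cons.prems] list by auto
  qed
qed

text \<open>The inverse of the first letter of \<open>r\<close> is pushed first and ends up deepest,
  so the letters arrive in the order of the inverse word.\<close>

lemma accepts_Before:
  assumes "g \<in> lists (letters X)"
  shows "accepts (munn_pda (letters X) \<Theta>) Drain Before w (stack g) \<longleftrightarrow>
    (\<exists>r\<in>lists (letters X). \<exists>v. w = map Some r @ None # v \<and>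
      hd (stack (foldr push (inv_word r) g)) \<in> \<Theta> \<and>
      accepts (munn_pda (letters X) \<Theta>) Drain After v (stack (foldr push (inv_word r) g)))"
  using assms
proof (induction w arbitrary: g)
  case Nil
  then show ?case by (subst accepts_Before_step) auto
next
  case (Cons x w)
  have list: "(\<exists>r\<in>lists (letters X). \<exists>v. x # w = map Some r @ None # v \<and> Q r v) \<longleftrightarrow>
      x = None \<and> Q [] w \<or>
      (\<exists>a\<in>letters X. x = Some a \<and> (\<exists>r\<in>lists (letters X). \<exists>v. w = map Some r @ None # v \<and> Q (a # r) v))"
    for Q
  proof
    assume "\<exists>r\<in>lists (letters X). \<exists>v. x # w = map Some r @ None # v \<and> Q r v"
    then obtain r v where "r \<in> lists (letters X)" "x # w = map Some r @ None # v" "Q r v" by blast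
    then show "x = None \<and> Q [] w \<or>
      (\<exists>a\<in>letters X. x = Some a \<and> (\<exists>r\<in>lists (letters X). \<exists>v. w = map Some r @ None # v \<and> Q (a # r) v))"
      by (cases r) auto
  next
    assume "x = None \<and> Q [] w \<or>
      (\<exists>a\<in>letters X. x = Some a \<and> (\<exists>r\<in>lists (letters X). \<exists>v. w = map Some r @ None # v \<and> Q (a # r) v))"
    then show "\<exists>r\<in>lists (letters X). \<exists>v. x # w = map Some r @ None # v \<and> Q r v"
    proof (elim disjE bexE conjE exE)
      assume "x = None" "Q [] w"
      then show ?thesis by (intro bexI[of _ "[]"]) auto
    next
      fix a r v assume "a \<in> letters X" "x = Some a" "r \<in> lists (letters X)"
        "w = map Some r @ None # v" "Q (a # r) v"
      then show ?thesis by (intro bexI[of _ "a # r"]) auto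
    qed
  qed
  show ?case
  proof (cases "\<exists>a\<in>letters X. x = Some a")
    case True
    then obtain a where a: "a \<in> letters X" "x = Some a" by blast
    then have "push (inv_letter a) g \<in> lists (letters X)"
      using Cons.prems push_lists inv_letter_mem by blast
    note IH = Cons.IH[OF this]
    show ?thesis
      unfolding accepts_Before_step[OF Cons.prems] list
      using a by (auto simp: IH)
  next
    case False
    then show ?thesis
      unfolding accepts_Before_step[OF Cons.prems] list by auto
  qed
qed

lemma accepts_Before_Nil:
  "accepts (munn_pda (letters X) \<Theta>) Drain Before w [None] \<longleftrightarrow>
    (\<exists>r\<in>lists (letters X). \<exists>s\<in>lists (letters X). w = hash_word r s \<and>
      reduce (rev s) \<noteq> reduce r \<and> hd (stack (reduce (inv_word r))) \<in> \<Theta> \<and>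
      (\<forall>x y. s = x @ y \<longrightarrow> y \<noteq> [] \<longrightarrow> hd (stack (reduce (rev x @ inv_word r))) \<in> \<Theta>))"
proof -
  have fold: "foldr push (rev x) (reduce (inv_word r)) = reduce (rev x @ inv_word r)"
    for x r :: "'a letter list"
    by (simp add: reduce_def)
  have mem: "reduce (inv_word r) \<in> lists (letters X)" if "r \<in> lists (letters X)" for r
    using that by (intro reduce_lists) auto
  have "accepts (munn_pda (letters X) \<Theta>) Drain Before w (stack []) \<longleftrightarrow>
    (\<exists>r\<in>lists (letters X). \<exists>v. w = map Some r @ None # v \<and>
      hd (stack (reduce (inv_word r))) \<in> \<Theta> \<and>
      accepts (munn_pda (letters X) \<Theta>) Drain After v (stack (reduce (inv_word r))))"
    by (subst accepts_Before) (auto simp: reduce_def)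
  also have "\<dots> \<longleftrightarrow> (\<exists>r\<in>lists (letters X). \<exists>s\<in>lists (letters X). w = hash_word r s \<and>
      reduce (rev s) \<noteq> reduce r \<and> hd (stack (reduce (inv_word r))) \<in> \<Theta> \<and>
      (\<forall>x y. s = x @ y \<longrightarrow> y \<noteq> [] \<longrightarrow> hd (stack (reduce (rev x @ inv_word r))) \<in> \<Theta>))"
    by (intro bex_cong refl)
      (auto simp: accepts_After[OF mem] fold hash_word_def reduce_append_inverse)
  finally show ?thesis by (simp add: stack_def)
qed

text \<open>When \<open>\<Theta>\<close> contains every stack symbol, the intermediate tests always
  succeed. What remains is the final test, which compares the values of \<open>u\<close> and
  \<open>v\<close>.\<close>

lemma accepts_reduce_neq:
  "accepts (munn_pda (letters X) (hash_alphabet (letters X))) Drain Before w [None] \<longleftrightarrow>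
    (\<exists>u\<in>lists (letters X). \<exists>v\<in>lists (letters X). w = hash_word u (rev v) \<and> reduce u \<noteq> reduce v)"
proof -
  have mem: "hd (stack (reduce (x @ inv_word r))) \<in> hash_alphabet (letters X)"
    if "r \<in> lists (letters X)" "x \<in> lists (letters X)" for r x
    using that by (intro hd_stack reduce_lists) auto
  have "accepts (munn_pda (letters X) (hash_alphabet (letters X))) Drain Before w [None] \<longleftrightarrow>
    (\<exists>u\<in>lists (letters X). \<exists>s\<in>lists (letters X). w = hash_word u s \<and> reduce (rev s) \<noteq> reduce u)"
    unfolding accepts_Before_Nil
    by (intro bex_cong refl) (use mem[of _ "[]"] in \<open>auto intro!: mem\<close>)
  also have "\<dots> \<longleftrightarrow> (\<exists>u\<in>lists (letters X). \<exists>s\<in>rev ` lists (letters X).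
      w = hash_word u s \<and> reduce u \<noteq> reduce (rev s))"
    unfolding vimage_rev[symmetric] by (intro bex_cong refl) auto
  finally show ?thesis by simp
qed

lemma suffix_values_rev: "suffix_values (rev s) = {reduce (rev x) | x y. s = x @ y}"
proof -
  have "rev s = p @ r \<longleftrightarrow> s = rev r @ rev p" for p r
    by (simp add: rev_swap)
  moreover have "(\<exists>p r. z = reduce r \<and> s = rev r @ rev p) \<longleftrightarrow> (\<exists>x y. z = reduce (rev x) \<and> s = x @ y)" for z
    by (metis rev_rev_ident)
  ultimately show ?thesis by (simp add: suffix_values_def)
qed

text \<open>As \<open>x\<close> runs through the prefixes of \<open>s\<close>, \<open>rev x\<close>
  runs through the suffixes of \<open>rev s\<close>. With only letters in \<open>\<Theta>\<close>,
  each of their values is required to differ from that of \<open>r\<close>.\<close>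

lemma accepts_new_suffix_value:
  "accepts (munn_pda (letters X) (Some ` letters X)) Drain Before w [None] \<longleftrightarrow>
    (\<exists>r\<in>lists (letters X). \<exists>s\<in>lists (letters X). w = hash_word r s \<and>
      reduce r \<notin> suffix_values (rev s))"
proof -
  have mem: "hd (stack (reduce (x @ inv_word r))) \<in> Some ` letters X \<longleftrightarrow> reduce x \<noteq> reduce r"
    if "r \<in> lists (letters X)" "x \<in> lists (letters X)" for r x
  proof -
    from that have "reduce (x @ inv_word r) \<in> lists (letters X)"
      by (intro reduce_lists) auto
    from hd_stack_Some[OF this] show ?thesis by (simp add: reduce_append_inverse)
  qed
  show ?thesis
    unfolding accepts_Before_Nil
  proof (intro bex_cong refl conj_cong)
    fix r s assume rs: "r \<in> lists (letters X)" "s \<in> lists (letters X)"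
    have nil: "hd (stack (reduce (inv_word r))) \<in> Some ` letters X \<longleftrightarrow> reduce [] \<noteq> reduce r"
      using mem[OF rs(1), of "[]"] by simp
    have "(\<forall>x y. s = x @ y \<longrightarrow> y \<noteq> [] \<longrightarrow>
        hd (stack (reduce (rev x @ inv_word r))) \<in> Some ` letters X) \<longleftrightarrow>
      (\<forall>x y. s = x @ y \<longrightarrow> y \<noteq> [] \<longrightarrow> reduce (rev x) \<noteq> reduce r)"
      using rs(2) by (intro all_cong1 imp_cong refl mem[OF rs(1)]) auto
    moreover have "reduce r \<in> suffix_values (rev s) \<longleftrightarrow> (\<exists>x y. s = x @ y \<and> reduce (rev x) = reduce r)"
      unfolding suffix_values_rev mem_Collect_eq by metis
    \<comment> \<open>The case \<open>y = []\<close> is split off because it is decided by the final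
      move, not by \<open>\<Theta>\<close>.\<close>
    moreover have "\<dots> \<longleftrightarrow> reduce (rev s) = reduce r \<or>
        (\<exists>x y. s = x @ y \<and> y \<noteq> [] \<and> reduce (rev x) = reduce r)"
      by (metis append_Nil2)
    \<comment> \<open>The test made at the hash is the instance of the empty prefix.\<close>
    moreover have "\<exists>x y. s = x @ y \<and> reduce (rev x) = reduce r" if "reduce [] = reduce r"
      using that by (intro exI[of _ "[]"] exI[of _ s]) simp
    ultimately show "(reduce (rev s) \<noteq> reduce r \<and> hd (stack (reduce (inv_word r))) \<in> Some ` letters X \<and>
        (\<forall>x y. s = x @ y \<longrightarrow> y \<noteq> [] \<longrightarrow>
          hd (stack (reduce (rev x @ inv_word r))) \<in> Some ` letters X)) \<longleftrightarrow>
      reduce r \<notin> suffix_values (rev s)"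
      unfolding nil by blast
  qed
qed

text \<open>The prefix skipped is arbitrary, so \<open>r\<close> ranges over all suffixes of
  \<open>u\<close>; one of them has to give a value missing from \<open>v\<close>.\<close>

lemma accepts_suffix_values:
  "accepts (munn_pda (letters X) (Some ` letters X)) Drain Skip w [None] \<longleftrightarrow>
    (\<exists>u\<in>lists (letters X). \<exists>v\<in>lists (letters X). w = hash_word u (rev v) \<and>
      \<not> suffix_values u \<subseteq> suffix_values v)"
proof
  assume "accepts (munn_pda (letters X) (Some ` letters X)) Drain Skip w [None]"
  then obtain p r s where *: "p \<in> lists (letters X)" "r \<in> lists (letters X)" "s \<in> lists (letters X)"
    "w = map Some p @ hash_word r s" "reduce r \<notin> suffix_values (rev s)"
    unfolding accepts_Skip accepts_new_suffix_value by blast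
  then have "reduce r \<in> suffix_values (p @ r)" by (auto simp: suffix_values_def)
  with * show "\<exists>u\<in>lists (letters X). \<exists>v\<in>lists (letters X). w = hash_word u (rev v) \<and>
      \<not> suffix_values u \<subseteq> suffix_values v"
    by (intro bexI[of _ "p @ r"] bexI[of _ "rev s"]) (auto simp: hash_word_def)
next
  assume "\<exists>u\<in>lists (letters X). \<exists>v\<in>lists (letters X). w = hash_word u (rev v) \<and>
      \<not> suffix_values u \<subseteq> suffix_values v"
  then obtain u v z where uv: "u \<in> lists (letters X)" "v \<in> lists (letters X)"
    "w = hash_word u (rev v)" "z \<in> suffix_values u" "z \<notin> suffix_values v" by blast
  from uv(4) obtain p r where "u = p @ r" "z = reduce r" by (auto simp: suffix_values_def)
  with uv have *: "p @ r \<in> lists (letters X)" "v \<in> lists (letters X)"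
    "w = hash_word (p @ r) (rev v)" "reduce r \<notin> suffix_values v" by auto
  have "accepts (munn_pda (letters X) (Some ` letters X)) Drain Before (hash_word r (rev v)) [None]"
    unfolding accepts_new_suffix_value using * by (intro bexI[of _ r] bexI[of _ "rev v"]) auto
  then show "accepts (munn_pda (letters X) (Some ` letters X)) Drain Skip w [None]"
    unfolding accepts_Skip using * by (intro bexI[of _ p]) (auto simp: hash_word_def)
qed

section \<open>Context-freeness of the accepted languages\<close>

lemma finite_letters: "finite X \<Longrightarrow> finite (letters X)"
  by (simp add: letters_def)

text \<open>Closure of \<open>A\<close> under inversion keeps the inverted letters pushed before the
  hash within the stack alphabet. The start state is left open since runs from \<open>Before\<close>
  and from \<open>Skip\<close> are both used.\<close>

lemma context_free_over_munn_pda: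
  assumes "finite A" "\<And>a. a \<in> A \<Longrightarrow> inv_letter a \<in> A" "\<Theta> \<subseteq> hash_alphabet A"
  shows "context_free_over (hash_alphabet A)
    {w \<in> lists (hash_alphabet A). accepts (munn_pda A \<Theta>) Drain q w [None]}"
proof (rule context_free_over_pda[where Q = "{Skip, Before, After, Drain}" and \<Gamma> = "hash_alphabet A"])
  have "finite (hash_alphabet A)" using assms(1) by (simp add: hash_alphabet_def)
  moreover from this have "finite \<Theta>" using assms(3) finite_subset by blast
  ultimately show "finite (hash_alphabet A)" "finite (munn_pda A \<Theta>)"
    using assms(1) by (simp_all add: munn_pda_def)
  have mem: "None \<in> hash_alphabet A" "Some a \<in> hash_alphabet A \<longleftrightarrow> a \<in> A" for a
    by (auto simp: hash_alphabet_def)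
  have "x \<in> hash_alphabet A" if "x \<in> set (push_sym a Z)" "a \<in> A" "Z \<in> hash_alphabet A" for x a Z
    using that by (auto simp: push_sym_def mem split: if_splits)
  then show "munn_pda A \<Theta> \<subseteq> {Skip, Before, After, Drain} \<times> lists (hash_alphabet A) \<times>
      hash_alphabet A \<times> {Skip, Before, After, Drain} \<times> lists (hash_alphabet A)"
    using assms(2,3) unfolding munn_pda_def
    by (auto simp: mem)
  show "q \<in> {Skip, Before, After, Drain}" by (cases q) auto
qed (use assms(1) in \<open>auto simp: hash_alphabet_def\<close>)

section \<open>Words with exactly one hash\<close>

lemma foldl_count_None:
  "n \<le> 2 \<Longrightarrow> foldl (\<lambda>n x. if x = None then min 2 (Suc n) else n) n w =
    min 2 (n + length (filter (\<lambda>x. x = None) w))"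
  by (induction w arbitrary: n) auto

lemma one_None_iff_hash_word:
  "length (filter (\<lambda>x. x = None) w) = 1 \<longleftrightarrow> (\<exists>u s. w = hash_word u s)"
proof
  assume "length (filter (\<lambda>x. x = None) w) = 1"
  then obtain x where "filter (\<lambda>x. x = None) w = [x]"
    by (auto simp: length_Suc_conv)
  then obtain y z where w: "w = y @ None # z" "\<forall>x\<in>set y. x \<noteq> None" "\<forall>x\<in>set z. x \<noteq> None"
    by (auto simp: filter_eq_Cons_iff filter_empty_conv eq_commute[of "[]"])
  then have "map Some (map the y) = y" "map Some (map the z) = z"
    by (auto simp: map_idI)
  with w(1) have "w = hash_word (map the y) (map the z)"
    unfolding hash_word_def by (simp del: map_map)
  then show "\<exists>u s. w = hash_word u s" by blast
qed (auto simp: hash_word_def)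

lemma hash_word_in_lists:
  "hash_word u s \<in> lists (hash_alphabet A) \<longleftrightarrow> u \<in> lists A \<and> s \<in> lists A"
  by (auto simp: hash_word_def hash_alphabet_def)

lemma hash_word_eq_iff: "hash_word u s = hash_word u' s' \<longleftrightarrow> u = u' \<and> s = s'"
proof
  assume eq: "hash_word u s = hash_word u' s'"
  have "takeWhile (\<lambda>x. x \<noteq> None) (hash_word u s) = map Some u" for u s :: "'a list"
    by (induction u) (auto simp: hash_word_def)
  then have "u = u'" using eq by (metis inj_map_eq_map inj_Some)
  with eq show "u = u' \<and> s = s'" by (auto simp: hash_word_def inj_map_eq_map)
qed simp

text \<open>For \<open>s = rev v\<close> reversal exchanges the roles of \<open>u\<close> and
  \<open>v\<close>, which turns the test for one inclusion into the test for the other.\<close>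

lemma rev_hash_word: "rev (hash_word u s) = hash_word (rev s) (rev u)"
  by (simp add: hash_word_def rev_map)

lemma word_problem_FIM:
  "word_problem (FIM X) FIM_gen (letters X) =
     {hash_word u (rev v) | u v. u \<in> lists (letters X) \<and> v \<in> lists (letters X) \<and>
        munn_tree u = munn_tree v}"
  by (simp add: word_problem_def word_eval_FIM hash_word_def)

theorem theorem4p1:
  fixes X :: "'a set"
  assumes "finite X"
  shows "co_context_free_over (hash_alphabet (letters X))
           (word_problem (FIM X) FIM_gen (letters X))"
proof -
  let ?A = "letters X"
  let ?\<Sigma> = "hash_alphabet ?A"
  let ?W = "word_problem (FIM X) FIM_gen ?A"
  define malformed where "malformed = {w \<in> lists ?\<Sigma>. \<nexists>u s. w = hash_word u s}"
  define neq where "neq = {w \<in> lists ?\<Sigma>.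
    accepts (munn_pda ?A ?\<Sigma>) Drain Before w [None]}"
  define extra where "extra = {w \<in> lists ?\<Sigma>.
    accepts (munn_pda ?A (Some ` ?A)) Drain Skip w [None]}"
  let ?K = "malformed \<union> neq \<union> extra \<union> rev ` extra"
  \<comment> \<open>A counter of hashes that stops at 2 has three states; 0 and 2 are the counts of
    words without exactly one hash.\<close>
  have "malformed = {w \<in> lists ?\<Sigma>.
      foldl (\<lambda>n x. if x = None then min 2 (Suc n) else n) 0 w \<in> {0, 2}}"
  proof -
    have "min 2 n \<in> {0, 2} \<longleftrightarrow> n \<noteq> 1" for n :: nat by auto
    then show ?thesis
      by (simp only: malformed_def one_None_iff_hash_word[symmetric] foldl_count_None[OF le0] add_0)
  qed
  also have "context_free_over ?\<Sigma> \<dots>"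
    by (rule context_free_over_automaton[where Q = "{..2}"])
      (use assms in \<open>auto simp: hash_alphabet_def finite_letters\<close>)
  finally have "context_free_over ?\<Sigma> malformed" .
  moreover have "context_free_over ?\<Sigma> neq" "context_free_over ?\<Sigma> extra"
    unfolding neq_def extra_def
    by (rule context_free_over_munn_pda; use assms in \<open>auto simp: finite_letters hash_alphabet_def\<close>)+
  ultimately have "context_free_over ?\<Sigma> ?K"
    by (intro context_free_over_Un context_free_over_rev)
  moreover have "?W = lists ?\<Sigma> - ?K"
  proof -
    have neq: "hash_word u (rev v) \<in> neq \<longleftrightarrow> reduce u \<noteq> reduce v"
      and extra: "hash_word u (rev v) \<in> extra \<longleftrightarrow> \<not> suffix_values u \<subseteq> suffix_values v"
      if "u \<in> lists ?A" "v \<in> lists ?A" for u v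
      using that
      by (auto simp: neq_def extra_def accepts_reduce_neq accepts_suffix_values hash_word_eq_iff
          hash_word_in_lists)
    have rev: "hash_word u (rev v) \<in> rev ` extra \<longleftrightarrow> hash_word v (rev u) \<in> extra" for u v
      by (metis image_iff rev_hash_word rev_rev_ident)
    have iff: "hash_word u (rev v) \<in> ?W \<longleftrightarrow> hash_word u (rev v) \<notin> ?K"
      if "u \<in> lists ?A" "v \<in> lists ?A" for u v
    proof -
      have "hash_word u (rev v) \<in> ?W \<longleftrightarrow> munn_tree u = munn_tree v"
        using that by (auto simp: word_problem_FIM hash_word_eq_iff)
      also have "\<dots> \<longleftrightarrow> hash_word u (rev v) \<notin> ?K"
        unfolding munn_tree_eq_iff_suffix_values
        \<comment> \<open>Both orders of \<open>u\<close> and \<open>v\<close> are used for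
          \<open>extra\<close>: the two inclusions together give equality of the suffix
          values.\<close>
        using neq[OF that] extra[OF that] extra[OF that(2,1)] rev[of u v]
        by (auto simp: malformed_def)
      finally show ?thesis .
    qed
    show ?thesis
    proof (intro equalityI subsetI)
      fix w assume w: "w \<in> ?W"
      then obtain u v where "w = hash_word u (rev v)" "u \<in> lists ?A" "v \<in> lists ?A"
        unfolding word_problem_FIM by blast
      with w iff[of u v] show "w \<in> lists ?\<Sigma> - ?K"
        by (auto simp: hash_word_in_lists)
    next
      fix w assume w: "w \<in> lists ?\<Sigma> - ?K"
      then have "\<exists>u s. w = hash_word u s" by (auto simp: malformed_def)
      then obtain u s where "w = hash_word u s" by blast
      \<comment> \<open>Every word after the hash is a reversal, so \<open>rev s\<close> serves as
        \<open>v\<close>.\<close>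
      with w have "w = hash_word u (rev (rev s))" "u \<in> lists ?A" "rev s \<in> lists ?A"
        by (auto simp: hash_word_in_lists)
      with w iff[of u "rev s"] show "w \<in> ?W" by auto
    qed
  qed
  ultimately show ?thesis unfolding co_context_free_over_def by blast
qed

end
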